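(* Let $a\in\mathbb{R}$, $\alpha>0$, let $w:\mathbb{N}_a\to\mathbb{R}\setminus\{0\}$ satisfy $\frac{w(a)}{w(k)}>0$ for all $k\in\mathbb{N}_{a+1}$, and let $u,v:\mathbb{N}_{a+1}\to\mathbb{R}_+$. If $p\ge 1$, then for all $k\in\mathbb{N}_{a+1}$, $$\big\{{}_a^{\rm G}\nabla_k^{-\alpha,w(k)}[u(k)+v(k)]^p\big\}^{\frac1p}\le \big[{}_a^{\rm G}\nabla_k^{-\alpha,w(k)}u^p(k)\big]^{\frac1p}+\big[{}_a^{\rm G}\nabla_k^{-\alpha,w(k)}v^p(k)\big]^{\frac1p}.$$ If $p\in(0,1)$, then for all $k\in\mathbb{N}_{a+1}$, $$\big\{{}_a^{\rm G}\nabla_k^{-\alpha,w(k)}[u(k)+v(k)]^p\big\}^{\frac1p}\ge \big[{}_a^{\rm G}\nabla_k^{-\alpha,w(k)}u^p(k)\big]^{\frac1p}+\big[{}_a^{\rm G}\nabla_k^{-\alpha,w(k)}v^p(k)\big]^{\frac1p}.$$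
   Context: For $a\in\mathbb{R}$, $\mathbb{N}_a:=\{a,a+1,a+2,\dots\}$. $\mathbb{R}_+$ is the set of positive real numbers. The rising function is $p^{\overline{q}}:=\frac{\Gamma(p+q)}{\Gamma(p)}$. For $\alpha>0$ and $k\in\mathbb{N}_{a+1}$, the Grünwald–Letnikov fractional sum is ${}_a^{\rm G}\nabla_k^{-\alpha}x(k):=\sum_{j=a+1}^{k}\frac{(k-j+1)^{\overline{\alpha-1}}}{\Gamma(\alpha)}x(j)$, and the tempered sum is ${}_a^{\rm G}\nabla_k^{-\alpha,w(k)}x(k):=w^{-1}(k)\,{}_a^{\rm G}\nabla_k^{-\alpha}[w(k)x(k)]=\sum_{j=a+1}^{k}\frac{(k-j+1)^{\overline{\alpha-1}}}{\Gamma(\alpha)}\frac{w(j)}{w(k)}x(j)$. The expression ${}_a^{\rm G}\nabla_k^{-\alpha,w(k)}[u(k)+v(k)]^p$ is the operator applied to the sequence $k\mapsto (u(k)+v(k))^p$. *)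

theory Defs
  imports "HOL-Analysis.Analysis"
begin

text \<open>Sequences on a shifted half-line \<open>a, a + 1, a + 2, \<dots>\<close> with real \<open>a\<close> are represented by functions
  on the reals; only their values on this set are ever used.\<close>

definition nats_from :: "real \<Rightarrow> real set" where
  "nats_from a = {a + real n | n. True}"

definition rising :: "real \<Rightarrow> real \<Rightarrow> real" where
  "rising p q = Gamma (p + q) / Gamma p"

definition gl_sum :: "real \<Rightarrow> real \<Rightarrow> (real \<Rightarrow> real) \<Rightarrow> real \<Rightarrow> real" where
  "gl_sum a \<alpha> x k =
     (\<Sum>j\<in>{j \<in> nats_from (a + 1). j \<le> k}. rising (k - j + 1) (\<alpha> - 1) / Gamma \<alpha> * x j)"

definition tempered_gl_sum ::
  "real \<Rightarrow> real \<Rightarrow> (real \<Rightarrow> real) \<Rightarrow> (real \<Rightarrow> real) \<Rightarrow> real \<Rightarrow> real" where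
  "tempered_gl_sum a \<alpha> w x k = inverse (w k) * gl_sum a \<alpha> (\<lambda>j. w j * x j) k"

lemma nats_from_atMost:
  "{j \<in> nats_from (a + 1). j \<le> a + real n} = (\<lambda>i. a + real i) ` {1..n}"
proof (intro equalityI subsetI)
  fix j assume "j \<in> {j \<in> nats_from (a + 1). j \<le> a + real n}"
  then obtain m where m: "j = a + 1 + real m" "j \<le> a + real n"
    by (auto simp: nats_from_def)
  then have "j = a + real (Suc m)" "Suc m \<in> {1..n}" by auto
  then show "j \<in> (\<lambda>i. a + real i) ` {1..n}" by blast
next
  fix j assume "j \<in> (\<lambda>i. a + real i) ` {1..n}"
  then obtain i where i: "j = a + real i" "1 \<le> i" "i \<le> n" by auto
  then have "j = a + 1 + real (i - 1)" by (simp add: of_nat_diff)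
  then have "j \<in> nats_from (a + 1)" unfolding nats_from_def by blast
  then show "j \<in> {j \<in> nats_from (a + 1). j \<le> a + real n}"
    using i by simp
qed

text \<open>In particular the summation range is finite for every \<open>k\<close> in the domain, so the sum is a
  genuine one.\<close>

lemma gl_sum_eq:
  "gl_sum a \<alpha> x (a + real n) =
     (\<Sum>i=1..n. rising (real n - real i + 1) (\<alpha> - 1) / Gamma \<alpha> * x (a + real i))"
  unfolding gl_sum_def nats_from_atMost
  by (subst sum.reindex) (auto simp: inj_on_def)

lemma tempered_gl_sum_eq:
  "tempered_gl_sum a \<alpha> w x k =
     (\<Sum>j\<in>{j \<in> nats_from (a + 1). j \<le> k}.
        rising (k - j + 1) (\<alpha> - 1) / Gamma \<alpha> * (w j / w k) * x j)"
  unfolding tempered_gl_sum_def gl_sum_def sum_distrib_left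
  by (rule sum.cong) (simp_all add: divide_inverse mult_ac)

end

theory Submission
  imports Defs
begin

text \<open>
  The tempered sum at a fixed \<open>k\<close> is a finite sum of the values of the sequence with positive weights:
  the coefficient \<open>\<Gamma> (k - j + \<alpha>) / (\<Gamma> (k - j + 1) \<Gamma> \<alpha>)\<close> is positive, and \<open>w j / w k > 0\<close> since both
  \<open>w j\<close> and \<open>w k\<close> have the sign of \<open>w a\<close>. The claim is therefore Minkowski's inequality for finite
  weighted sums, together with its reversal for exponents below one.

  Both directions come from one application of Jensen's inequality. Let \<open>A\<close> and \<open>B\<close> be the weighted \<open>p\<close>-norms of \<open>f\<close> and \<open>g\<close>. Then
  \<open>(f + g) / (A + B)\<close> is the convex combination of the normalised functions \<open>f / A\<close> and \<open>g / B\<close> with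
  coefficients \<open>A / (A + B)\<close> and \<open>B / (A + B)\<close>. Applying \<open>x powr p\<close> pointwise and summing against the
  weights, the right-hand side adds up to exactly one, so the weighted \<open>p\<close>-norm of \<open>f + g\<close> is at most
  \<open>A + B\<close> when the power is convex and at least \<open>A + B\<close> when it is concave.
\<close>

definition wnorm :: "real \<Rightarrow> 'a set \<Rightarrow> ('a \<Rightarrow> real) \<Rightarrow> ('a \<Rightarrow> real) \<Rightarrow> real" where
  "wnorm p S c f = (\<Sum>i\<in>S. c i * f i powr p) powr (1 / p)"

lemma powr_concave:
  assumes "0 \<le> p" "p \<le> 1"
  shows "concave_on {0<..} (\<lambda>x::real. x powr p)"
proof (rule f''_le0_imp_concave)
  show "((\<lambda>x. x powr p) has_real_derivative p * x powr (p - 1)) (at x)" if "x \<in> {0<..}" for x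
    using that by (auto intro!: derivative_eq_intros)
  show "((\<lambda>x. p * x powr (p - 1)) has_real_derivative p * ((p - 1) * x powr (p - 1 - 1))) (at x)"
    if "x \<in> {0<..}" for x
    using that by (auto intro!: derivative_eq_intros)
  show "p * ((p - 1) * x powr (p - 1 - 1)) \<le> 0" for x
    using assms by (intro mult_nonneg_nonpos mult_nonpos_nonneg) auto
qed simp

lemma wnorm_pos:
  assumes "finite S" "S \<noteq> {}" "\<And>i. i \<in> S \<Longrightarrow> 0 < c i" "\<And>i. i \<in> S \<Longrightarrow> 0 < f i"
  shows "0 < wnorm p S c f"
proof -
  have "0 < (\<Sum>i\<in>S. c i * f i powr p)"
    using assms(1,2)
  proof (rule sum_pos)
    show "0 < c i * f i powr p" if "i \<in> S" for i
      using assms(3,4)[OF that] by simp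
  qed
  then show ?thesis by (simp add: wnorm_def)
qed

lemma wnorm_powr:
  assumes "p \<noteq> 0" "\<And>i. i \<in> S \<Longrightarrow> 0 < c i"
  shows "wnorm p S c f powr p = (\<Sum>i\<in>S. c i * f i powr p)"
proof -
  have "0 \<le> (\<Sum>i\<in>S. c i * f i powr p)"
    using assms by (intro sum_nonneg mult_nonneg_nonneg) (auto intro: less_imp_le)
  then show ?thesis using assms by (simp add: wnorm_def powr_powr)
qed

lemma sum_powr_normalised:
  fixes f :: "'a \<Rightarrow> real"
  assumes "p \<noteq> 0" "0 < N" "\<And>i. i \<in> S \<Longrightarrow> 0 < f i"
  shows "(\<Sum>i\<in>S. c i * (f i / N) powr p) = (\<Sum>i\<in>S. c i * f i powr p) / N powr p"
  unfolding sum_divide_distrib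
  using assms by (auto simp: powr_divide less_imp_le intro!: sum.cong)

text \<open>The value one of the right-hand side of the summed Jensen inequality: each normalised function
  has weighted \<open>p\<close>-norm one, and the two coefficients add up to one.\<close>

lemma sum_convex_comb_normalised:
  fixes f g :: "'a \<Rightarrow> real"
  assumes "finite S" "S \<noteq> {}" "p \<noteq> 0"
    and pos: "\<And>i. i \<in> S \<Longrightarrow> 0 < c i" "\<And>i. i \<in> S \<Longrightarrow> 0 < f i" "\<And>i. i \<in> S \<Longrightarrow> 0 < g i"
  defines "A \<equiv> wnorm p S c f" and "B \<equiv> wnorm p S c g"
  shows "(\<Sum>i\<in>S. c i * (A / (A + B) * (f i / A) powr p + B / (A + B) * (g i / B) powr p)) = 1"
proof -
  have A: "0 < A" and B: "0 < B"
    unfolding A_def B_def using assms(1,2) pos by (auto intro: wnorm_pos)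
  have "(\<Sum>i\<in>S. c i * (f i / A) powr p) = 1"
    using sum_powr_normalised[of p A S f c] wnorm_powr[of p S c f, folded A_def] assms(3) pos A
    by (metis divide_self less_irrefl powr_gt_zero)
  moreover have "(\<Sum>i\<in>S. c i * (g i / B) powr p) = 1"
    using sum_powr_normalised[of p B S g c] wnorm_powr[of p S c g, folded B_def] assms(3) pos B
    by (metis divide_self less_irrefl powr_gt_zero)
  moreover have "(\<Sum>i\<in>S. c i * (A / (A + B) * (f i / A) powr p + B / (A + B) * (g i / B) powr p))
      = A / (A + B) * (\<Sum>i\<in>S. c i * (f i / A) powr p)
        + B / (A + B) * (\<Sum>i\<in>S. c i * (g i / B) powr p)"
    by (simp add: sum_distrib_left sum.distrib[symmetric] algebra_simps)
  moreover have "A / (A + B) + B / (A + B) = 1"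
    using A B by (simp add: add_divide_distrib[symmetric])
  ultimately show ?thesis by simp
qed

lemma convex_comb_normalised:
  fixes A B x y :: real
  assumes "0 < A" "0 < B"
  shows "(A / (A + B)) *\<^sub>R (x / A) + (B / (A + B)) *\<^sub>R (y / B) = (x + y) / (A + B)"
  using assms by (simp add: add_divide_distrib)

text \<open>Minkowski's inequality, by convexity of the power applied to the normalised functions.\<close>

lemma wnorm_triangle:
  fixes f g :: "'a \<Rightarrow> real"
  assumes "finite S" "S \<noteq> {}" "1 \<le> p"
    and pos: "\<And>i. i \<in> S \<Longrightarrow> 0 < c i" "\<And>i. i \<in> S \<Longrightarrow> 0 < f i" "\<And>i. i \<in> S \<Longrightarrow> 0 < g i"
  shows "wnorm p S c (\<lambda>i. f i + g i) \<le> wnorm p S c f + wnorm p S c g"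
proof -
  define A where "A = wnorm p S c f"
  define B where "B = wnorm p S c g"
  have A: "0 < A" and B: "0 < B"
    unfolding A_def B_def using assms(1,2) pos by (auto intro: wnorm_pos)
  have pointwise: "((f i + g i) / (A + B)) powr p \<le> A / (A + B) * (f i / A) powr p + B / (A + B) * (g i / B) powr p"
    if "i \<in> S" for i
  proof -
    have "f i / A \<in> {0<..}" "g i / B \<in> {0<..}" using that A B pos by auto
    moreover have "0 \<le> A / (A + B)" "0 \<le> B / (A + B)" "A / (A + B) + B / (A + B) = 1"
      using A B by (auto simp: add_divide_distrib[symmetric])
    ultimately show ?thesis
      using powr_convex[of p] assms(3) unfolding convex_on_def convex_comb_normalised[OF A B, symmetric]
      by blast
  qed
  have "(\<Sum>i\<in>S. c i * ((f i + g i) / (A + B)) powr p)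
      \<le> (\<Sum>i\<in>S. c i * (A / (A + B) * (f i / A) powr p + B / (A + B) * (g i / B) powr p))"
    using pos pointwise by (intro sum_mono mult_left_mono) (auto intro: less_imp_le)
  then have "(\<Sum>i\<in>S. c i * (f i + g i) powr p) / (A + B) powr p \<le> 1"
    using sum_convex_comb_normalised[of S p c f g] sum_powr_normalised[of p "A + B" S "\<lambda>i. f i + g i" c]
      assms A B by (simp add: A_def B_def add_pos_pos)
  then have "(\<Sum>i\<in>S. c i * (f i + g i) powr p) \<le> (A + B) powr p"
    using A B by (simp add: divide_le_eq add_pos_pos)
  then have "wnorm p S c (\<lambda>i. f i + g i) \<le> ((A + B) powr p) powr (1 / p)"
    unfolding wnorm_def using assms by (intro powr_mono2 sum_nonneg mult_nonneg_nonneg) (auto intro: less_imp_le)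
  then show ?thesis using assms A B by (simp add: A_def B_def powr_powr)
qed

text \<open>For exponents below one the power is concave, so the same normalisation
  bounds the norm of the sum from below.\<close>

lemma wnorm_reverse_triangle:
  fixes f g :: "'a \<Rightarrow> real"
  assumes "finite S" "S \<noteq> {}" "0 < p" "p < 1"
    and pos: "\<And>i. i \<in> S \<Longrightarrow> 0 < c i" "\<And>i. i \<in> S \<Longrightarrow> 0 < f i" "\<And>i. i \<in> S \<Longrightarrow> 0 < g i"
  shows "wnorm p S c f + wnorm p S c g \<le> wnorm p S c (\<lambda>i. f i + g i)"
proof -
  define A where "A = wnorm p S c f"
  define B where "B = wnorm p S c g"
  have A: "0 < A" and B: "0 < B"
    unfolding A_def B_def using assms(1,2) pos by (auto intro: wnorm_pos)
  have pointwise: "A / (A + B) * (f i / A) powr p + B / (A + B) * (g i / B) powr p \<le> ((f i + g i) / (A + B)) powr p"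
    if "i \<in> S" for i
  proof -
    have "f i / A \<in> {0<..}" "g i / B \<in> {0<..}" using that A B pos by auto
    moreover have "0 \<le> A / (A + B)" "0 \<le> B / (A + B)" "A / (A + B) + B / (A + B) = 1"
      using A B by (auto simp: add_divide_distrib[symmetric])
    ultimately show ?thesis
      using powr_concave[OF less_imp_le[OF assms(3)] less_imp_le[OF assms(4)]]
      unfolding concave_on_iff convex_comb_normalised[OF A B, symmetric]
      by blast
  qed
  have "(\<Sum>i\<in>S. c i * (A / (A + B) * (f i / A) powr p + B / (A + B) * (g i / B) powr p))
      \<le> (\<Sum>i\<in>S. c i * ((f i + g i) / (A + B)) powr p)"
    using pos pointwise by (intro sum_mono mult_left_mono) (auto intro: less_imp_le)
  then have "1 \<le> (\<Sum>i\<in>S. c i * (f i + g i) powr p) / (A + B) powr p"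
    using sum_convex_comb_normalised[of S p c f g] sum_powr_normalised[of p "A + B" S "\<lambda>i. f i + g i" c]
      assms A B by (simp add: A_def B_def add_pos_pos)
  then have "(A + B) powr p \<le> (\<Sum>i\<in>S. c i * (f i + g i) powr p)"
    using A B by (simp add: le_divide_eq add_pos_pos)
  then have "((A + B) powr p) powr (1 / p) \<le> wnorm p S c (\<lambda>i. f i + g i)"
    unfolding wnorm_def using assms by (intro powr_mono2 sum_nonneg mult_nonneg_nonneg) (auto intro: less_imp_le)
  then show ?thesis using assms A B by (simp add: A_def B_def powr_powr)
qed

lemma rising_pos:
  assumes "0 < p" "0 < p + q"
  shows "0 < rising p q"
  using assms by (simp add: rising_def)

lemma finite_nats_from_atMost:
  assumes "k \<in> nats_from (a + 1)"
  shows "finite {j \<in> nats_from (a + 1). j \<le> k}"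
proof -
  obtain n where "k = a + real (Suc n)"
    using assms by (auto simp: nats_from_def)
  then show ?thesis by (simp only: nats_from_atMost) simp
qed

theorem theorem3p19:
  fixes a \<alpha> p :: real and w u v :: "real \<Rightarrow> real"
  assumes "\<alpha> > 0"
    and "\<forall>k\<in>nats_from a. w k \<noteq> 0"
    and "\<forall>k\<in>nats_from (a + 1). w a / w k > 0"
    and "\<forall>k\<in>nats_from (a + 1). u k > 0"
    and "\<forall>k\<in>nats_from (a + 1). v k > 0"
  shows "(p \<ge> 1 \<longrightarrow> (\<forall>k\<in>nats_from (a + 1).
            tempered_gl_sum a \<alpha> w (\<lambda>j. (u j + v j) powr p) k powr (1 / p)
              \<le> tempered_gl_sum a \<alpha> w (\<lambda>j. u j powr p) k powr (1 / p)
                + tempered_gl_sum a \<alpha> w (\<lambda>j. v j powr p) k powr (1 / p)))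
       \<and> (0 < p \<and> p < 1 \<longrightarrow> (\<forall>k\<in>nats_from (a + 1).
            tempered_gl_sum a \<alpha> w (\<lambda>j. (u j + v j) powr p) k powr (1 / p)
              \<ge> tempered_gl_sum a \<alpha> w (\<lambda>j. u j powr p) k powr (1 / p)
                + tempered_gl_sum a \<alpha> w (\<lambda>j. v j powr p) k powr (1 / p)))"
proof -
  define c where "c k j = rising (k - j + 1) (\<alpha> - 1) / Gamma \<alpha> * (w j / w k)" for k j
  define S where "S k = {j \<in> nats_from (a + 1). j \<le> k}" for k
  have norm: "tempered_gl_sum a \<alpha> w (\<lambda>j. f j powr p) k powr (1 / p) = wnorm p (S k) (c k) f" for f k
    by (simp add: tempered_gl_sum_eq wnorm_def c_def S_def)
  have S: "finite (S k)" "S k \<noteq> {}" if "k \<in> nats_from (a + 1)" for k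
    using that finite_nats_from_atMost by (auto simp: S_def)
  have c: "0 < c k j" if "k \<in> nats_from (a + 1)" "j \<in> S k" for k j
  proof -
    have "0 < rising (k - j + 1) (\<alpha> - 1)"
      using that assms(1) by (intro rising_pos) (auto simp: S_def)
    moreover have "0 < w a / w k" "0 < w a / w j"
      using that assms(3) unfolding S_def by blast+
    then have "0 < w j / w k" by (auto simp: zero_less_divide_iff)
    ultimately show ?thesis
      unfolding c_def using assms(1) by (meson mult_pos_pos divide_pos_pos Gamma_real_pos)
  qed
  have uv: "0 < u j" "0 < v j" if "j \<in> S k" for j k
    using that assms(4,5) by (auto simp: S_def)
  show ?thesis
    unfolding norm using S c uv by (auto intro!: wnorm_triangle wnorm_reverse_triangle)
qed

end
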